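(* Let $n\ge 2$ and let $$y^{(n)}+A_n^2\,y^{(n-2)}+\dots+A_n^j\,y^{(n-j)}+\dots+A_n^n\,y=0$$ be a linear iterative equation in normal form, and put $\mathfrak{q}=A_n^2/\binom{n+1}{3}$. Let $u$ be a nowhere vanishing solution (on the interval considered) of the second-order source equation $y''+\mathfrak{q}\,y=0$. Then $n$ linearly independent solutions of the $n$th-order equation are given by $$y_k=u^{\,n-1}\left(\int\frac{dx}{u^2}\right)^{k},\qquad k=0,\dots,n-1,$$ where $\int \frac{dx}{u^2}$ denotes a fixed antiderivative of $1/u^2$.
   Context: All functions are smooth functions of $x$ and all considerations are local (on sufficiently small intervals). Superscripts on $A_n^j$ are indices, not powers. Two equations differing by multiplication by a nowhere vanishing function of $x$ are regarded as the same equation. Iterative equations: let $r$ (nowhere zero) and $s$ be smooth functions of $x$, and let $\Psi=r\frac{d}{dx}+s$, so $\Psi[y]=ry'+sy$. Put $\Psi^0=I$ (identity) and $\Psi^n[y]=\Psi^{n-1}(\Psi[y])$ for $n\ge1$. A linear equation of order $n$ is called iterative if it is of the form $\Psi^n[y]=0$ for some such $r,s$. *)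

theory Defs
  imports "HOL-Analysis.Analysis"
begin

text \<open>All notions below are meant for an open set \<open>I\<close>, so that differentiability at the points of
  \<open>I\<close> and the values of \<^const>\<open>deriv\<close> there depend only on the restriction of a function to \<open>I\<close>.\<close>

definition smooth_on :: "real set \<Rightarrow> (real \<Rightarrow> real) \<Rightarrow> bool" where
  "smooth_on I f \<longleftrightarrow> (\<forall>k. \<forall>x\<in>I. (deriv ^^ k) f differentiable (at x))"

definition Psi :: "(real \<Rightarrow> real) \<Rightarrow> (real \<Rightarrow> real) \<Rightarrow> (real \<Rightarrow> real) \<Rightarrow> real \<Rightarrow> real" where
  "Psi r s y = (\<lambda>x. r x * deriv y x + s x * y x)"

text \<open>A linear differential operator \<open>L\<close> stands for the equation \<open>L[y] = 0\<close>.
  Two equations are identified when the operators differ by a nowhere vanishing smooth factor.\<close>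

definition same_equation ::
  "real set \<Rightarrow> ((real \<Rightarrow> real) \<Rightarrow> real \<Rightarrow> real) \<Rightarrow> ((real \<Rightarrow> real) \<Rightarrow> real \<Rightarrow> real) \<Rightarrow> bool" where
  "same_equation I L M \<longleftrightarrow>
     (\<exists>m. smooth_on I m \<and> (\<forall>x\<in>I. m x \<noteq> 0) \<and>
          (\<forall>y. smooth_on I y \<longrightarrow> (\<forall>x\<in>I. M y x = m x * L y x)))"

definition iterative_equation ::
  "real set \<Rightarrow> nat \<Rightarrow> ((real \<Rightarrow> real) \<Rightarrow> real \<Rightarrow> real) \<Rightarrow> bool" where
  "iterative_equation I n L \<longleftrightarrow>
     (\<exists>r s. smooth_on I r \<and> smooth_on I s \<and> (\<forall>x\<in>I. r x \<noteq> 0) \<and>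
            same_equation I L (Psi r s ^^ n))"

text \<open>Only the coefficients \<open>A 2, \<dots>, A n\<close> are used.\<close>

definition normal_form_op ::
  "nat \<Rightarrow> (nat \<Rightarrow> real \<Rightarrow> real) \<Rightarrow> (real \<Rightarrow> real) \<Rightarrow> real \<Rightarrow> real" where
  "normal_form_op n A y = (\<lambda>x. (deriv ^^ n) y x + (\<Sum>j=2..n. A j x * (deriv ^^ (n - j)) y x))"

definition solution_on ::
  "real set \<Rightarrow> ((real \<Rightarrow> real) \<Rightarrow> real \<Rightarrow> real) \<Rightarrow> (real \<Rightarrow> real) \<Rightarrow> bool" where
  "solution_on I L y \<longleftrightarrow> smooth_on I y \<and> (\<forall>x\<in>I. L y x = 0)"

text \<open>Linear independence over the reals of the restrictions of \<open>y 0, \<dots>, y (n - 1)\<close> to \<open>I\<close>.\<close>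

definition linearly_independent_on :: "real set \<Rightarrow> nat \<Rightarrow> (nat \<Rightarrow> real \<Rightarrow> real) \<Rightarrow> bool" where
  "linearly_independent_on I n y \<longleftrightarrow>
     (\<forall>c :: nat \<Rightarrow> real. (\<forall>x\<in>I. (\<Sum>k<n. c k * y k x) = 0) \<longrightarrow> (\<forall>k<n. c k = 0))"

end

theory Submission
  imports Defs "HOL-Computational_Algebra.Polynomial"
begin

text \<open>Write the equation as \<open>\<Psi>\<^sup>n[y] = 0\<close> with \<open>\<Psi> = r d/dx + s\<close>. Being in normal form is a strong
  restriction on \<open>\<Psi>\<close>. Expanding \<open>\<Psi>\<^sup>n\<close> and comparing the coefficients of the derivatives of order
  \<open>n\<close>, \<open>n - 1\<close> and \<open>n - 2\<close> shows (\<open>iterative_normal_form_coeffs\<close>) that the common factor is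
  \<open>r\<^sup>n\<close>, that \<open>s = -(n - 1) r' / 2\<close>, and that \<open>q r\<^sup>2 = (r'\<^sup>2 - 2 r r'') / 4\<close>. The last equation says
  precisely that \<open>v = sqrt \<bar>r\<bar>\<close> solves the source equation \<open>v'' + q v = 0\<close>.

  Now let \<open>u\<close> be any nowhere vanishing solution of the source equation and \<open>F' = 1 / u\<^sup>2\<close>. The
  Wronskian of \<open>u\<close> and \<open>v\<close> is a constant \<open>b\<close>, so \<open>(v / u)' = b F'\<close> and \<open>v = u (a + b F)\<close> for some
  constant \<open>a\<close>; hence \<open>r = \<sigma> u\<^sup>2 (a + b F)\<^sup>2\<close> with a constant sign \<open>\<sigma>\<close>
  (\<open>leading_coeff_factorization\<close>). Consequently, for a polynomial \<open>h\<close>,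
  \<open>\<Psi>[u\<^sup>n\<^sup>-\<^sup>1 h(F)] = \<sigma> u\<^sup>n\<^sup>-\<^sup>1 ((a + b F)\<^sup>2 h'(F) - (n - 1) b (a + b F) h(F))\<close>.
  On polynomials of degree less than \<open>n\<close> this operator is nilpotent of order \<open>n\<close>: each application
  splits off one more factor \<open>a + b F\<close> and lowers the degree of the cofactor
  (\<open>Psi_funpow_gauged_poly_eq_0\<close>). So \<open>u\<^sup>n\<^sup>-\<^sup>1 F\<^sup>k\<close> is a solution for every \<open>k < n\<close>. The solutions are
  independent because \<open>F\<close> is strictly increasing, so that a relation between them would be a
  polynomial with infinitely many roots.\<close>

section \<open>Smooth functions on an open set\<close>

lemma deriv_cong_on_open:
  fixes f g :: "real \<Rightarrow> real"
  assumes "open I" "x \<in> I" "\<And>x. x \<in> I \<Longrightarrow> f x = g x"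
  shows "deriv f x = deriv g x"
  using assms by (intro deriv_cong_ev) (auto simp: eventually_nhds)

lemma differentiable_cong_on_open:
  fixes f g :: "real \<Rightarrow> real"
  assumes "open I" "x \<in> I" "\<And>x. x \<in> I \<Longrightarrow> f x = g x" "f differentiable (at x)"
  shows "g differentiable (at x)"
  using assms unfolding differentiable_def
  by (meson has_derivative_transform_within_open)

text \<open>The recursion peels off derivatives from the inside, which lets the
  closure properties below be proved by induction on the order: the derivative of a product or
  of a reciprocal is again built from functions differentiable one time less.\<close>

primrec diff_upto :: "real set \<Rightarrow> nat \<Rightarrow> (real \<Rightarrow> real) \<Rightarrow> bool" where
  "diff_upto I 0 f \<longleftrightarrow> True"
| "diff_upto I (Suc k) f \<longleftrightarrow> (\<forall>x\<in>I. f differentiable (at x)) \<and> diff_upto I k (deriv f)"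

lemma diff_upto_iff:
  "diff_upto I k f \<longleftrightarrow> (\<forall>j<k. \<forall>x\<in>I. (deriv ^^ j) f differentiable (at x))"
proof (induction k arbitrary: f)
  case (Suc k)
  have "(deriv ^^ Suc j) f = (deriv ^^ j) (deriv f)" for j
    by (simp only: funpow_Suc_right o_apply)
  then show ?case
    by (simp only: diff_upto.simps Suc All_less_Suc2 funpow_0)
qed simp

lemma smooth_on_iff_diff_upto: "smooth_on I f \<longleftrightarrow> (\<forall>k. diff_upto I k f)"
  unfolding smooth_on_def diff_upto_iff by blast

lemma diff_upto_SucD: "diff_upto I (Suc k) f \<Longrightarrow> diff_upto I k f"
  unfolding diff_upto_iff by (meson less_SucI)

lemma diff_upto_cong:
  assumes "open I" "\<And>x. x \<in> I \<Longrightarrow> f x = g x" "diff_upto I k f"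
  shows "diff_upto I k g"
  using assms(2,3)
proof (induction k arbitrary: f g)
  case (Suc k)
  have "diff_upto I k (deriv g)"
  proof (rule Suc.IH)
    show "deriv f x = deriv g x" if "x \<in> I" for x
      using that Suc.prems(1) by (rule deriv_cong_on_open[OF assms(1)])
    show "diff_upto I k (deriv f)"
      using Suc.prems(2) by simp
  qed
  moreover have "g differentiable (at x)" if "x \<in> I" for x
    by (rule differentiable_cong_on_open[OF assms(1) that Suc.prems(1)])
       (use Suc.prems(2) that in auto)
  ultimately show ?case
    by simp
qed simp

lemma diff_upto_const: "diff_upto I k (\<lambda>x. c)"
  by (induction k arbitrary: c) auto

lemma diff_upto_add:
  assumes "open I" "diff_upto I k f" "diff_upto I k g"
  shows "diff_upto I k (\<lambda>x. f x + g x)"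
  using assms(2,3)
proof (induction k arbitrary: f g)
  case (Suc k)
  have "diff_upto I k (\<lambda>x. deriv f x + deriv g x)"
    using Suc.prems by (intro Suc.IH) auto
  then have "diff_upto I k (deriv (\<lambda>x. f x + g x))"
  proof (rule diff_upto_cong[OF assms(1), rotated])
    fix x assume "x \<in> I"
    then have "(f has_real_derivative deriv f x) (at x)" "(g has_real_derivative deriv g x) (at x)"
      using Suc.prems by (auto simp: DERIV_deriv_iff_real_differentiable)
    then show "deriv f x + deriv g x = deriv (\<lambda>x. f x + g x) x"
      by (intro DERIV_imp_deriv[symmetric]) (auto intro!: derivative_eq_intros)
  qed
  then show ?case
    using Suc.prems by simp
qed simp

lemma diff_upto_mult:
  assumes "open I" "diff_upto I k f" "diff_upto I k g"
  shows "diff_upto I k (\<lambda>x. f x * g x)"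
  using assms(2,3)
proof (induction k arbitrary: f g)
  case (Suc k)
  have "diff_upto I k (\<lambda>x. f x * deriv g x + deriv f x * g x)"
    using Suc.prems Suc.prems[THEN diff_upto_SucD]
    by (intro diff_upto_add[OF assms(1)] Suc.IH) auto
  then have "diff_upto I k (deriv (\<lambda>x. f x * g x))"
  proof (rule diff_upto_cong[OF assms(1), rotated])
    fix x assume "x \<in> I"
    then have "(f has_real_derivative deriv f x) (at x)" "(g has_real_derivative deriv g x) (at x)"
      using Suc.prems by (auto simp: DERIV_deriv_iff_real_differentiable)
    then show "f x * deriv g x + deriv f x * g x = deriv (\<lambda>x. f x * g x) x"
      by (intro DERIV_imp_deriv[symmetric]) (auto intro!: derivative_eq_intros)
  qed
  then show ?case
    using Suc.prems by simp
qed simp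

lemma diff_upto_inverse:
  assumes "open I" "diff_upto I k f" "\<And>x. x \<in> I \<Longrightarrow> f x \<noteq> 0"
  shows "diff_upto I k (\<lambda>x. inverse (f x))"
  using assms(2)
proof (induction k)
  case (Suc k)
  have inv: "diff_upto I k (\<lambda>x. inverse (f x))"
    by (rule Suc.IH[OF diff_upto_SucD[OF Suc.prems]])
  have "diff_upto I k (\<lambda>x. (- 1) * deriv f x * (inverse (f x) * inverse (f x)))"
    using Suc.prems inv by (intro diff_upto_mult[OF assms(1)] diff_upto_const) auto
  then have "diff_upto I k (deriv (\<lambda>x. inverse (f x)))"
  proof (rule diff_upto_cong[OF assms(1), rotated])
    fix x assume "x \<in> I"
    then have "(f has_real_derivative deriv f x) (at x)" "f x \<noteq> 0"
      using Suc.prems assms(3) by (auto simp: DERIV_deriv_iff_real_differentiable)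
    then show "(- 1) * deriv f x * (inverse (f x) * inverse (f x)) = deriv (\<lambda>x. inverse (f x)) x"
      by (intro DERIV_imp_deriv[symmetric]) (auto intro!: derivative_eq_intros)
  qed
  then show ?case
    using Suc.prems assms(3) by (auto intro: differentiable_inverse)
qed simp

lemma smooth_on_differentiable: "smooth_on I f \<Longrightarrow> x \<in> I \<Longrightarrow> f differentiable (at x)"
  unfolding smooth_on_def by (metis funpow_0)

lemma smooth_on_DERIV:
  "smooth_on I f \<Longrightarrow> x \<in> I \<Longrightarrow> (f has_real_derivative deriv f x) (at x)"
  using smooth_on_differentiable DERIV_deriv_iff_real_differentiable by blast

lemma smooth_on_deriv: "smooth_on I f \<Longrightarrow> smooth_on I (deriv f)"
  by (metis smooth_on_iff_diff_upto diff_upto.simps(2))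

lemma smooth_on_funpow_deriv: "smooth_on I f \<Longrightarrow> smooth_on I ((deriv ^^ k) f)"
  by (induction k) (auto intro: smooth_on_deriv)

lemma smooth_on_const: "smooth_on I (\<lambda>x. c)"
  by (simp add: smooth_on_iff_diff_upto diff_upto_const)

lemma smooth_on_add:
  "open I \<Longrightarrow> smooth_on I f \<Longrightarrow> smooth_on I g \<Longrightarrow> smooth_on I (\<lambda>x. f x + g x)"
  by (simp add: smooth_on_iff_diff_upto diff_upto_add)

lemma smooth_on_mult:
  "open I \<Longrightarrow> smooth_on I f \<Longrightarrow> smooth_on I g \<Longrightarrow> smooth_on I (\<lambda>x. f x * g x)"
  by (simp add: smooth_on_iff_diff_upto diff_upto_mult)

lemma smooth_on_inverse:
  "open I \<Longrightarrow> smooth_on I f \<Longrightarrow> (\<And>x. x \<in> I \<Longrightarrow> f x \<noteq> 0) \<Longrightarrow> smooth_on I (\<lambda>x. inverse (f x))"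
  by (simp add: smooth_on_iff_diff_upto diff_upto_inverse)

lemma smooth_on_power: "open I \<Longrightarrow> smooth_on I f \<Longrightarrow> smooth_on I (\<lambda>x. f x ^ k)"
  by (induction k) (auto intro: smooth_on_const smooth_on_mult)

lemma smooth_on_antiderivative:
  assumes "open I" "smooth_on I f" "\<And>x. x \<in> I \<Longrightarrow> (F has_real_derivative f x) (at x)"
  shows "smooth_on I F"
  unfolding smooth_on_iff_diff_upto
proof
  fix k
  have "diff_upto I k' (deriv F)" for k'
    by (rule diff_upto_cong[OF assms(1), of f])
       (use assms in \<open>auto simp: smooth_on_iff_diff_upto DERIV_imp_deriv[THEN sym]\<close>)
  then show "diff_upto I k F"
    using assms(3) by (cases k) (auto simp: real_differentiable_def)
qed

lemma smooth_on_shift_power: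
  assumes "open I"
  shows "smooth_on I (\<lambda>x. (x - c) ^ k)"
proof -
  have "smooth_on I (\<lambda>x. x - c)"
    by (rule smooth_on_antiderivative[OF assms smooth_on_const[of _ 1]])
       (auto intro!: derivative_eq_intros)
  then show ?thesis
    by (rule smooth_on_power[OF assms])
qed

lemma higher_deriv_shift_power:
  fixes c :: real
  shows "(deriv ^^ i) (\<lambda>x. (x - c) ^ k) = (\<lambda>x. pochhammer (real k - real i + 1) i * (x - c) ^ (k - i))"
proof (induction i)
  case (Suc i)
  have "deriv (\<lambda>x. pochhammer (real k - real i + 1) i * (x - c) ^ (k - i)) x =
        pochhammer (real k - real i + 1) i * (real (k - i) * (x - c) ^ (k - i - 1))" for x
    by (rule DERIV_imp_deriv) (auto intro!: derivative_eq_intros)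
  moreover have "pochhammer (real k - real i + 1) i * real (k - i) =
      pochhammer (real k - real (Suc i) + 1) (Suc i)" if "i \<le> k"
    using that by (simp add: pochhammer_rec of_nat_diff algebra_simps)
  moreover have "pochhammer (real k - real i + 1) i * real (k - i) =
      pochhammer (real k - real (Suc i) + 1) (Suc i)" if "\<not> i \<le> k"
  proof -
    have "pochhammer (- real (i - k)) (Suc i) = 0"
      using that by (intro pochhammer_of_nat_eq_0_lemma) simp
    then show ?thesis
      using that by (simp add: of_nat_diff)
  qed
  ultimately show ?case
    using Suc by (force simp: mult.assoc[symmetric])
qed simp

text \<open>These monomials serve as test functions: evaluated at \<open>c\<close>, a linear differential operator applied
  to one of them shows a single coefficient.\<close>

lemma higher_deriv_shift_power_at:
  fixes c :: real
  shows "(deriv ^^ i) (\<lambda>x. (x - c) ^ k) c = (if i = k then fact k else 0)"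
proof (cases "k < i")
  case True
  have "pochhammer (- real (i - Suc k)) i = 0"
    using True by (intro pochhammer_of_nat_eq_0_lemma) simp
  then show ?thesis
    using True by (simp add: higher_deriv_shift_power of_nat_diff add.commute add_diff_eq)
next
  case False
  then show ?thesis
    by (auto simp: higher_deriv_shift_power pochhammer_fact power_0_left)
qed

section \<open>The coefficients of an iterated first-order operator\<close>

text \<open>The recursion in the order comes from \<open>r (c y\<^sup>(\<^sup>i\<^sup>))' + s c y\<^sup>(\<^sup>i\<^sup>) = r c y\<^sup>(\<^sup>i\<^sup>+\<^sup>1\<^sup>) + (r c' + s c) y\<^sup>(\<^sup>i\<^sup>)\<close>.\<close>

primrec psi_coeff :: "(real \<Rightarrow> real) \<Rightarrow> (real \<Rightarrow> real) \<Rightarrow> nat \<Rightarrow> nat \<Rightarrow> real \<Rightarrow> real" where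
  "psi_coeff r s 0 i = (\<lambda>x. if i = 0 then 1 else 0)"
| "psi_coeff r s (Suc k) i = (\<lambda>x. r x * (if i = 0 then 0 else psi_coeff r s k (i - 1) x)
      + (r x * deriv (psi_coeff r s k i) x + s x * psi_coeff r s k i x))"

lemma psi_coeff_eq_0: "k < i \<Longrightarrow> psi_coeff r s k i = (\<lambda>x. 0)"
  by (induction k arbitrary: i) auto

lemma smooth_on_psi_coeff:
  assumes "open I" "smooth_on I r" "smooth_on I s"
  shows "smooth_on I (psi_coeff r s k i)"
proof (induction k arbitrary: i)
  case 0
  show ?case by (simp add: smooth_on_const)
next
  case (Suc k)
  have "smooth_on I (\<lambda>x. if i = 0 then 0 else psi_coeff r s k (i - 1) x)"
    using Suc by (cases "i = 0") (auto simp: smooth_on_const)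
  then show ?case
    using assms Suc by (auto intro!: smooth_on_add smooth_on_mult smooth_on_deriv)
qed

lemma Psi_funpow_expansion:
  assumes "open I" "smooth_on I r" "smooth_on I s" "smooth_on I y" "x \<in> I"
  shows "(Psi r s ^^ k) y x = (\<Sum>i\<le>k. psi_coeff r s k i x * (deriv ^^ i) y x)"
  using assms(5)
proof (induction k arbitrary: x)
  case (Suc k)
  let ?c = "psi_coeff r s k" and ?D = "\<lambda>i. (deriv ^^ i) y"
  have "deriv ((Psi r s ^^ k) y) x = deriv (\<lambda>x. \<Sum>i\<le>k. ?c i x * ?D i x) x"
    using Suc by (intro deriv_cong_on_open[OF assms(1)])
  also have "\<dots> = (\<Sum>i\<le>k. deriv (?c i) x * ?D i x + ?c i x * ?D (Suc i) x)"
  proof (rule DERIV_imp_deriv, rule DERIV_sum)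
    fix i
    have "(?c i has_real_derivative deriv (?c i) x) (at x)"
      using smooth_on_DERIV smooth_on_psi_coeff assms(1-3) Suc.prems by blast
    moreover have "(?D i has_real_derivative ?D (Suc i) x) (at x)"
      using smooth_on_DERIV[OF smooth_on_funpow_deriv[OF assms(4)] Suc.prems] by simp
    ultimately show "((\<lambda>x. ?c i x * ?D i x) has_real_derivative
        deriv (?c i) x * ?D i x + ?c i x * ?D (Suc i) x) (at x)"
      by (auto intro!: derivative_eq_intros)
  qed
  finally have d: "deriv ((Psi r s ^^ k) y) x = \<dots>" .
  have "(Psi r s ^^ Suc k) y x = r x * deriv ((Psi r s ^^ k) y) x + s x * (Psi r s ^^ k) y x"
    by (simp add: Psi_def)
  then have "(Psi r s ^^ Suc k) y x = r x * (\<Sum>i\<le>k. ?c i x * ?D (Suc i) x)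
      + (\<Sum>i\<le>k. (r x * deriv (?c i) x + s x * ?c i x) * ?D i x)"
    unfolding d Suc.IH[OF Suc.prems] by (simp add: sum.distrib sum_distrib_left algebra_simps)
  moreover have "(\<Sum>i\<le>k. (r x * deriv (?c i) x + s x * ?c i x) * ?D i x)
      = (\<Sum>i\<le>Suc k. (r x * deriv (?c i) x + s x * ?c i x) * ?D i x)"
    by (simp add: psi_coeff_eq_0)
  moreover have "r x * (\<Sum>i\<le>k. ?c i x * ?D (Suc i) x)
      = (\<Sum>i\<le>Suc k. r x * (if i = 0 then 0 else ?c (i - 1) x) * ?D i x)"
    by (subst sum.atMost_Suc_shift) (simp add: sum_distrib_left mult.assoc)
  ultimately show ?case
    by (simp only: psi_coeff.simps distrib_right sum.distrib)
qed simp

lemma psi_coeff_top: "psi_coeff r s k k x = r x ^ k"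
  by (induction k arbitrary: x) (auto simp: psi_coeff_eq_0)

lemma psi_coeff_second:
  assumes "open I" "smooth_on I r" "x \<in> I"
  shows "psi_coeff r s (Suc k) k x
    = r x ^ k * (real (k + 1) * s x + real (k * (k + 1)) / 2 * deriv r x)"
proof (induction k)
  case (Suc k)
  have "((\<lambda>x. r x ^ Suc k) has_real_derivative real (Suc k) * r x ^ k * deriv r x) (at x)"
    using DERIV_power_Suc[OF smooth_on_DERIV[OF assms(2,3)], of k] by (simp add: mult_ac)
  moreover have "deriv (psi_coeff r s (Suc k) (Suc k)) x = deriv (\<lambda>x. r x ^ Suc k) x"
    by (intro deriv_cong_on_open[OF assms(1,3)] psi_coeff_top)
  ultimately have d: "deriv (psi_coeff r s (Suc k) (Suc k)) x = real (Suc k) * r x ^ k * deriv r x"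
    by (simp only: DERIV_imp_deriv)
  show ?case
    unfolding psi_coeff.simps(2)[of r s "Suc k" "Suc k"] d
    by (simp only: Suc psi_coeff_top nat.distinct if_False diff_Suc_1) (simp add: field_simps)
qed simp

text \<open>The closed form solves the recursion in \<open>k\<close> that results from inserting
  \<open>psi_coeff_second\<close>. Summing it up produces multiples of \<open>(k + 2) choose 2\<close>, \<open>(k + 2) choose 3\<close>
  and \<open>(k + 2) choose 4\<close>; the three summands below correspond to them, after extraction of the
  factor \<open>(k + 2) (k + 1)\<close>.\<close>

lemma psi_coeff_third:
  assumes "open I" "smooth_on I r" "smooth_on I s" "x \<in> I"
  shows "psi_coeff r s (Suc (Suc k)) k x = r x ^ k * real ((k + 2) * (k + 1)) *
    (((s x)\<^sup>2 + r x * deriv s x) / 2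
      + real k / 6 * (3 * deriv r x * s x + r x * deriv (deriv r) x + (deriv r x)\<^sup>2)
      + real k * (real k - 1) / 8 * (deriv r x)\<^sup>2)"
proof (induction k)
  case 0
  have "psi_coeff r s (Suc 0) 0 = s" by auto
  then show ?case
    by (simp add: psi_coeff.simps(2)[of r s "Suc 0"] power2_eq_square del: psi_coeff.simps)
next
  case (Suc k)
  let ?R = "\<lambda>x. r x ^ Suc k * (real (Suc k + 1) * s x + real (Suc k * (Suc k + 1)) / 2 * deriv r x)"
  have "(?R has_real_derivative
      real (Suc k) * r x ^ k * deriv r x *
        (real (Suc k + 1) * s x + real (Suc k * (Suc k + 1)) / 2 * deriv r x)
      + r x ^ Suc k *
        (real (Suc k + 1) * deriv s x + real (Suc k * (Suc k + 1)) / 2 * deriv (deriv r) x)) (at x)"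
  proof (rule DERIV_cong[OF DERIV_mult[OF DERIV_power_Suc]])
    show "(r has_real_derivative deriv r x) (at x)"
      by (rule smooth_on_DERIV[OF assms(2,4)])
    show "((\<lambda>x. real (Suc k + 1) * s x + real (Suc k * (Suc k + 1)) / 2 * deriv r x)
        has_real_derivative
        (real (Suc k + 1) * deriv s x + real (Suc k * (Suc k + 1)) / 2 * deriv (deriv r) x)) (at x)"
      by (intro DERIV_add DERIV_cmult smooth_on_DERIV[OF _ assms(4)] assms(2,3) smooth_on_deriv)
  qed (simp add: mult_ac)
  moreover have "deriv (psi_coeff r s (Suc (Suc k)) (Suc k)) x = deriv ?R x"
    using psi_coeff_second[OF assms(1,2)] by (intro deriv_cong_on_open[OF assms(1,4)])
  ultimately have d: "deriv (psi_coeff r s (Suc (Suc k)) (Suc k)) x =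
      real (Suc k) * r x ^ k * deriv r x *
        (real (Suc k + 1) * s x + real (Suc k * (Suc k + 1)) / 2 * deriv r x)
      + r x ^ Suc k *
        (real (Suc k + 1) * deriv s x + real (Suc k * (Suc k + 1)) / 2 * deriv (deriv r) x)"
    by (simp only: DERIV_imp_deriv)
  show ?case
    unfolding psi_coeff.simps(2)[of r s "Suc (Suc k)" "Suc k"] d
    by (simp only: Suc psi_coeff_second[OF assms(1,2,4)] nat.distinct if_False diff_Suc_1)
       (simp add: field_simps power2_eq_square)
qed

section \<open>Iterative equations in normal form\<close>

lemma normal_form_op_shift_power:
  assumes "i \<le> n"
  shows "normal_form_op n A (\<lambda>x. (x - c) ^ i) c
    = fact i * (if i = n then 1 else if i + 2 \<le> n then A (n - i) c else 0)"
proof -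
  have "(\<Sum>j=2..n. A j c * (if n - j = i then fact i else 0))
      = (\<Sum>j=2..n. if j = n - i then A j c * fact i else 0)"
    using assms by (intro sum.cong) auto
  then show ?thesis
    using assms by (auto simp: normal_form_op_def higher_deriv_shift_power_at)
qed

text \<open>The absence of a derivative of order \<open>n - 1\<close> in a normal form determines \<open>s\<close> from \<open>r\<close>, and then
  the coefficient of order \<open>n - 2\<close> determines \<open>A 2\<close> from \<open>r\<close>. The right-hand side of the second
  equation depends on \<open>n\<close> only through the binomial coefficient, which is why \<open>A 2\<close> is divided by it
  to form the source equation.\<close>

lemma iterative_normal_form_coeffs:
  assumes "open I" "smooth_on I r" "smooth_on I s" "\<And>x. x \<in> I \<Longrightarrow> r x \<noteq> 0"
    and "same_equation I (normal_form_op n A) (Psi r s ^^ n)"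
    and "n \<ge> 2" "x \<in> I"
  shows "s x = - (real n - 1) / 2 * deriv r x"
    and "A 2 x * (r x)\<^sup>2 = real ((n + 1) choose 3) * ((deriv r x)\<^sup>2 - 2 * r x * deriv (deriv r) x) / 4"
proof -
  obtain k where k: "n = Suc (Suc k)"
    using \<open>n \<ge> 2\<close> by (metis add_2_eq_Suc le_Suc_ex)
  obtain m where m: "\<And>y x. smooth_on I y \<Longrightarrow> x \<in> I \<Longrightarrow>
      (Psi r s ^^ n) y x = m x * normal_form_op n A y x"
    using assms(5) unfolding same_equation_def by blast
  \<comment> \<open>Evaluating both operators on \<open>(t - x)\<^sup>i\<close> at \<open>t = x\<close> isolates the coefficient of the
    \<open>i\<close>-th derivative.\<close>
  have coeff: "psi_coeff r s n i x
      = m x * (if i = n then 1 else if i + 2 \<le> n then A (n - i) x else 0)"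
    if "i \<le> n" "x \<in> I" for i x
  proof -
    have "(Psi r s ^^ n) (\<lambda>t. (t - x) ^ i) x = psi_coeff r s n i x * fact i"
    proof -
      have "(Psi r s ^^ n) (\<lambda>t. (t - x) ^ i) x
          = (\<Sum>j\<le>n. psi_coeff r s n j x * (if j = i then fact i else 0))"
        using that assms(1-3) smooth_on_shift_power
        by (simp add: Psi_funpow_expansion higher_deriv_shift_power_at)
      also have "\<dots> = (\<Sum>j\<le>n. if j = i then psi_coeff r s n j x * fact i else 0)"
        by (intro sum.cong) auto
      finally show ?thesis using that by simp
    qed
    with m[OF smooth_on_shift_power[OF assms(1)] that(2), of x i] show ?thesis
      using that by (simp add: normal_form_op_shift_power)
  qed
  have s: "s x = - (real n - 1) / 2 * deriv r x" if "x \<in> I" for x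
  proof -
    have "psi_coeff r s n (Suc k) x = 0"
      using coeff[of "Suc k" x] that k by (simp del: psi_coeff.simps)
    then have "real (Suc k + 1) * s x + real (Suc k * (Suc k + 1)) / 2 * deriv r x = 0"
      using psi_coeff_second[OF assms(1,2) that, of s "Suc k"] assms(4)[OF that] k
      by (simp del: psi_coeff.simps)
    then have "real (k + 2) * (s x + (real n - 1) / 2 * deriv r x) = 0"
      using k by (simp add: field_simps)
    moreover have "real (k + 2) \<noteq> 0" by simp
    ultimately have "s x + (real n - 1) / 2 * deriv r x = 0"
      using mult_eq_0_iff by blast
    then show ?thesis by (simp add: field_simps)
  qed
  show "s x = - (real n - 1) / 2 * deriv r x"
    using s \<open>x \<in> I\<close> .
  have "deriv s x = deriv (\<lambda>x. - (real n - 1) / 2 * deriv r x) x"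
    using s by (intro deriv_cong_on_open[OF assms(1) \<open>x \<in> I\<close>])
  also have "\<dots> = - (real n - 1) / 2 * deriv (deriv r) x"
    by (rule DERIV_imp_deriv)
       (use smooth_on_DERIV[OF smooth_on_deriv[OF assms(2)] \<open>x \<in> I\<close>] in
         \<open>auto intro!: derivative_eq_intros\<close>)
  finally have s': "deriv s x = - (real n - 1) / 2 * deriv (deriv r) x" .
  have "psi_coeff r s n n x = m x"
    using coeff[of n x] \<open>x \<in> I\<close> by simp
  then have mx: "m x = r x ^ n"
    by (simp add: psi_coeff_top)
  have "r x ^ k * (A 2 x * (r x)\<^sup>2) = m x * A 2 x"
    by (simp add: mx k power2_eq_square)
  also have "\<dots> = psi_coeff r s n k x"
    using coeff[of k x] \<open>x \<in> I\<close> k by (simp del: psi_coeff.simps)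
  also have "\<dots> = r x ^ k * (real ((k + 2) * (k + 1)) *
    (((s x)\<^sup>2 + r x * deriv s x) / 2
      + real k / 6 * (3 * deriv r x * s x + r x * deriv (deriv r) x + (deriv r x)\<^sup>2)
      + real k * (real k - 1) / 8 * (deriv r x)\<^sup>2))"
    by (simp only: k psi_coeff_third[OF assms(1-3) \<open>x \<in> I\<close>] mult.assoc)
  finally have "A 2 x * (r x)\<^sup>2 = real ((k + 2) * (k + 1)) *
    (((s x)\<^sup>2 + r x * deriv s x) / 2
      + real k / 6 * (3 * deriv r x * s x + r x * deriv (deriv r) x + (deriv r x)\<^sup>2)
      + real k * (real k - 1) / 8 * (deriv r x)\<^sup>2)"
    using assms(4)[OF \<open>x \<in> I\<close>] by simp
  also have "\<dots> = real (k + 3) * real (k + 2) * real (k + 1) / 6 *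
      ((deriv r x)\<^sup>2 - 2 * r x * deriv (deriv r) x) / 4"
    unfolding s[OF \<open>x \<in> I\<close>] s' k by (simp add: field_simps power2_eq_square)
  also have "real (k + 3) * real (k + 2) * real (k + 1) / 6 = real ((n + 1) choose 3)"
    unfolding k by (simp add: binomial_gbinomial gbinomial_prod_rev eval_nat_numeral field_simps)
  finally show "A 2 x * (r x)\<^sup>2
      = real ((n + 1) choose 3) * ((deriv r x)\<^sup>2 - 2 * r x * deriv (deriv r) x) / 4" .
qed

section \<open>The leading coefficient in terms of a solution of the source equation\<close>

lemma const_sign_on_interval:
  fixes r :: "real \<Rightarrow> real"
  assumes "is_interval I" "continuous_on I r" "\<And>x. x \<in> I \<Longrightarrow> r x \<noteq> 0"
  shows "\<exists>\<sigma>::real. \<sigma>\<^sup>2 = 1 \<and> (\<forall>x\<in>I. \<sigma> * r x > 0)"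
proof -
  have "connected (r ` I)"
    using assms by (intro connected_continuous_image) (auto simp: is_interval_connected)
  then have iv: "is_interval (r ` I)"
    by (simp add: is_interval_connected_1)
  have "(\<forall>x\<in>I. r x > 0) \<or> (\<forall>x\<in>I. r x < 0)"
  proof (rule ccontr)
    assume "\<not> ?thesis"
    then obtain x y where "x \<in> I" "y \<in> I" "r x \<le> 0" "0 \<le> r y"
      by (auto simp: not_less)
    then have "0 \<in> r ` I"
      using iv unfolding is_interval_1 by blast
    then show False using assms(3) by auto
  qed
  then show ?thesis
  proof
    assume "\<forall>x\<in>I. r x > 0"
    then show ?thesis by (intro exI[of _ 1]) simp
  next
    assume "\<forall>x\<in>I. r x < 0"
    then show ?thesis by (intro exI[of _ "-1"]) simp
  qed
qed

text \<open>The hypothesis on \<open>q\<close> makes \<open>v = sqrt (\<sigma> r)\<close>, where \<open>\<sigma>\<close> is the sign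
  of \<open>r\<close>, a second solution of the source equation: differentiating
  \<open>v\<^sup>2 = \<sigma> r\<close> twice gives \<open>4 v\<^sup>3 v'' = 2 r r'' - r'\<^sup>2\<close>. Reduction of order by \<open>u\<close> then expresses \<open>v\<close>
  through \<open>u\<close> and \<open>F\<close>.\<close>

lemma leading_coeff_factorization:
  fixes r u q F :: "real \<Rightarrow> real"
  assumes I: "open I" "is_interval I" and r: "smooth_on I r" "\<And>x. x \<in> I \<Longrightarrow> r x \<noteq> 0"
    and q: "\<And>x. x \<in> I \<Longrightarrow> q x * (r x)\<^sup>2 = ((deriv r x)\<^sup>2 - 2 * r x * deriv (deriv r) x) / 4"
    and u: "smooth_on I u" "\<And>x. x \<in> I \<Longrightarrow> deriv (deriv u) x + q x * u x = 0"
    and u_nz: "\<And>x. x \<in> I \<Longrightarrow> u x \<noteq> 0"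
    and F: "\<And>x. x \<in> I \<Longrightarrow> (F has_real_derivative 1 / (u x)\<^sup>2) (at x)"
  obtains \<sigma> a b where "\<And>x. x \<in> I \<Longrightarrow> r x = \<sigma> * (u x)\<^sup>2 * (a + b * F x)\<^sup>2"
proof -
  have cont: "continuous_on I r"
    using smooth_on_DERIV[OF r(1)] DERIV_isCont by (intro continuous_at_imp_continuous_on) blast
  obtain \<sigma> where \<sigma>: "\<sigma>\<^sup>2 = 1" "\<And>x. x \<in> I \<Longrightarrow> \<sigma> * r x > 0"
    using const_sign_on_interval[OF I(2) cont r(2)] by blast
  define v where "v x = sqrt (\<sigma> * r x)" for x
  define v1 where "v1 x = \<sigma> * deriv r x / (2 * v x)" for x
  have v: "v x > 0" "(v x)\<^sup>2 = \<sigma> * r x" if "x \<in> I" for x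
    using \<sigma>(2)[OF that] by (auto simp: v_def)
  have dv: "(v has_real_derivative v1 x) (at x)" if "x \<in> I" for x
    unfolding v_def[abs_def] v1_def
    using smooth_on_DERIV[OF r(1) that] \<sigma>(2)[OF that]
    by (auto intro!: derivative_eq_intros simp: field_simps)
  have dv1: "(v1 has_real_derivative - q x * v x) (at x)" if "x \<in> I" for x
  proof -
    have "(v1 has_real_derivative
        (\<sigma> * deriv (deriv r) x * (2 * v x) - \<sigma> * deriv r x * (2 * v1 x)) / (2 * v x)\<^sup>2) (at x)"
      unfolding v1_def[abs_def]
      using smooth_on_DERIV[OF smooth_on_deriv[OF r(1)] that] dv[OF that] v(1)[OF that]
      by (auto intro!: derivative_eq_intros simp: power2_eq_square v1_def)
    also have "(\<sigma> * deriv (deriv r) x * (2 * v x) - \<sigma> * deriv r x * (2 * v1 x)) / (2 * v x)\<^sup>2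
        = (2 * \<sigma> * deriv (deriv r) x * (v x)\<^sup>2 - \<sigma>\<^sup>2 * (deriv r x)\<^sup>2) / (4 * (v x)^3)"
      using v(1)[OF that] by (simp add: v1_def field_simps power2_eq_square power3_eq_cube)
    also have "\<dots> = - (q x * (r x)\<^sup>2) / (v x)^3"
      unfolding v(2)[OF that] q[OF that] using \<sigma>(1) v(1)[OF that]
      by (simp add: field_simps power2_eq_square)
    also have "(r x)\<^sup>2 = (v x)^4"
    proof -
      have "(v x)^4 = ((v x)\<^sup>2)\<^sup>2" by simp
      then show ?thesis unfolding v(2)[OF that] using \<sigma>(1) by (simp add: power_mult_distrib)
    qed
    also have "- (q x * (v x)^4) / (v x)^3 = - q x * v x"
      using v(1)[OF that] by (simp add: field_simps eval_nat_numeral)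
    finally show ?thesis .
  qed
  note du = smooth_on_DERIV[OF u(1)] and du1 = smooth_on_DERIV[OF smooth_on_deriv[OF u(1)]]
  \<comment> \<open>The Wronskian of two solutions of \<open>y'' + q y = 0\<close> is constant.\<close>
  have "\<exists>b. \<forall>x\<in>I. u x * v1 x - deriv u x * v x = b"
  proof (rule has_field_derivative_zero_constant)
    show "convex I" using I(2) by (simp add: is_interval_convex)
    fix x assume x: "x \<in> I"
    have "deriv (deriv u) x = - q x * u x"
      using u(2)[OF x] by simp
    then have "deriv u x * v1 x + - q x * v x * u x
        - (deriv (deriv u) x * v x + v1 x * deriv u x) = 0"
      by simp
    then show "((\<lambda>x. u x * v1 x - deriv u x * v x) has_real_derivative 0) (at x within I)"
      using DERIV_diff[OF DERIV_mult[OF du[OF x] dv1[OF x]] DERIV_mult[OF du1[OF x] dv[OF x]]]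
      by (metis has_field_derivative_at_within)
  qed
  then obtain b where b: "\<And>x. x \<in> I \<Longrightarrow> u x * v1 x - deriv u x * v x = b"
    by blast
  have "\<exists>a. \<forall>x\<in>I. v x / u x - b * F x = a"
  proof (rule has_field_derivative_zero_constant)
    show "convex I" using I(2) by (simp add: is_interval_convex)
    fix x assume x: "x \<in> I"
    have "(v1 x * u x - v x * deriv u x) / (u x * u x) - b * (1 / (u x)\<^sup>2) = 0"
      using u_nz[OF x] b[OF x] by (simp add: field_simps power2_eq_square)
    then show "((\<lambda>x. v x / u x - b * F x) has_real_derivative 0) (at x within I)"
      using DERIV_diff[OF DERIV_divide[OF dv[OF x] du[OF x] u_nz[OF x]] DERIV_cmult[OF F[OF x]]]
      by (metis has_field_derivative_at_within)
  qed
  then obtain a where a: "\<And>x. x \<in> I \<Longrightarrow> v x / u x - b * F x = a"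
    by blast
  show ?thesis
  proof (rule that[of \<sigma> a b])
    fix x assume x: "x \<in> I"
    have "v x = u x * (a + b * F x)"
      unfolding a[OF x, symmetric] using u_nz[OF x] by simp
    then have "(u x)\<^sup>2 * (a + b * F x)\<^sup>2 = \<sigma> * r x"
      using v(2)[OF x] by (simp add: power_mult_distrib)
    then show "r x = \<sigma> * (u x)\<^sup>2 * (a + b * F x)\<^sup>2"
      using \<sigma>(1) by (simp add: power2_eq_square mult.assoc)
  qed
qed

section \<open>Nilpotency on polynomials in the new variable\<close>

text \<open>With \<open>F\<close> as the independent variable and in the gauge \<open>u\<^sup>N\<close>, the operator is
  \<open>\<sigma> ((a + b F)\<^sup>2 \<partial>\<^sub>F - N b (a + b F))\<close>. Splitting off the power of \<open>a + b F\<close> that the earlier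
  applications have produced leaves an operator on polynomials whose leading terms cancel when
  the polynomial has degree \<open>N - d\<close>.\<close>

lemma Psi_gauged_poly:
  fixes r s u F :: "real \<Rightarrow> real" and p :: "real poly"
  assumes I: "open I" "x \<in> I"
    and u: "\<And>x. x \<in> I \<Longrightarrow> (u has_real_derivative u' x) (at x)" "\<And>x. x \<in> I \<Longrightarrow> u x \<noteq> 0"
    and F: "\<And>x. x \<in> I \<Longrightarrow> (F has_real_derivative 1 / (u x)\<^sup>2) (at x)"
    and r: "\<And>x. x \<in> I \<Longrightarrow> r x = \<sigma> * (u x)\<^sup>2 * (a + b * F x)\<^sup>2"
    and s: "\<And>x. x \<in> I \<Longrightarrow> s x = - real N / 2 * deriv r x"
    and y: "\<And>x. x \<in> I \<Longrightarrow> y x = u x ^ N * (a + b * F x) ^ d * poly p (F x)"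
  shows "Psi r s y x = u x ^ N * (a + b * F x) ^ Suc d *
    poly (smult \<sigma> ([:a, b:] * pderiv p - smult (b * (real N - real d)) p)) (F x)"
proof -
  let ?l = "a + b * F x" and ?p = "poly p (F x)" and ?p' = "poly (pderiv p) (F x)"
  note ux = u(1)[OF I(2)] and u0 = u(2)[OF I(2)] and Fx = F[OF I(2)]
  have "deriv r x = deriv (\<lambda>x. \<sigma> * (u x)\<^sup>2 * (a + b * F x)\<^sup>2) x"
    using r by (intro deriv_cong_on_open[OF I])
  also have "\<dots> = \<sigma> * (2 * u x * u' x * ?l\<^sup>2 + 2 * b * ?l)"
    using ux Fx u0
    by (intro DERIV_imp_deriv) (auto intro!: derivative_eq_intros simp: field_simps power2_eq_square)
  finally have dr: "deriv r x = \<sigma> * (2 * u x * u' x * ?l\<^sup>2 + 2 * b * ?l)" .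
  have dp: "((\<lambda>x. poly p (F x)) has_real_derivative ?p' * (1 / (u x)\<^sup>2)) (at x)"
    by (rule DERIV_chain2[OF poly_DERIV Fx])
  have "deriv y x = deriv (\<lambda>x. u x ^ N * (a + b * F x) ^ d * poly p (F x)) x"
    using y by (intro deriv_cong_on_open[OF I])
  also have "\<dots> = real N * u x ^ (N - 1) * u' x * ?l ^ d * ?p
      + u x ^ N * (real d * ?l ^ (d - 1) * (b / (u x)\<^sup>2)) * ?p + u x ^ N * ?l ^ d * (?p' / (u x)\<^sup>2)"
    using ux Fx dp by (intro DERIV_imp_deriv) (auto intro!: derivative_eq_intros simp: algebra_simps)
  finally have dy: "deriv y x = \<dots>" .
  have uN: "(u x)\<^sup>2 * (real N * u x ^ (N - 1)) = u x * (real N * u x ^ N)"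
    by (cases N) (auto simp: power2_eq_square)
  have ld: "?l\<^sup>2 * (real d * ?l ^ (d - 1)) = ?l * (real d * ?l ^ d)"
    by (cases d) (auto simp: power2_eq_square)
  have "r x * deriv y x =
      \<sigma> * (?l\<^sup>2 * u' x * ((u x)\<^sup>2 * (real N * u x ^ (N - 1))) * ?l ^ d * ?p
      + (u x)\<^sup>2 * (b / (u x)\<^sup>2) * u x ^ N * (?l\<^sup>2 * (real d * ?l ^ (d - 1))) * ?p
      + (u x)\<^sup>2 * (?p' / (u x)\<^sup>2) * u x ^ N * ?l ^ d * ?l\<^sup>2)"
    unfolding dy r[OF I(2)] by (simp add: algebra_simps)
  also have "\<dots> = \<sigma> * (?l\<^sup>2 * u' x * (u x * (real N * u x ^ N)) * ?l ^ d * ?p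
      + b * u x ^ N * (?l * (real d * ?l ^ d)) * ?p + ?p' * u x ^ N * ?l ^ d * ?l\<^sup>2)"
    unfolding uN ld using u0 by simp
  finally have "Psi r s y x = \<dots> + s x * y x"
    unfolding Psi_def by simp
  then show ?thesis
    unfolding s[OF I(2)] dr y[OF I(2)] by (simp add: algebra_simps power2_eq_square)
qed

text \<open>On \<open>t\<^sup>j\<close> the top-degree term of \<open>(a + b t) p'\<close> is \<open>b j t\<^sup>j\<close>, cancelled by the subtracted multiple
  of \<open>p\<close>.\<close>

lemma coeff_gauged_step_eq_0:
  fixes p :: "real poly"
  assumes "\<And>i. i > j \<Longrightarrow> coeff p i = 0" "i \<ge> j"
  shows "coeff ([:a, b:] * pderiv p - smult (b * real j) p) i = 0"
  using assms(2) assms(1)[of i] assms(1)[of "Suc i"] assms(1)[of "Suc (Suc i)"]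
  by (cases i; cases "i = j") (auto simp: coeff_pderiv coeff_pCons algebra_simps)

text \<open>The vanishing of coefficients from \<open>j\<close> on stands for a degree less than \<open>j\<close>; for \<open>j = 0\<close> it says
  \<open>p = 0\<close>, which ends the induction. The exponent \<open>Suc N - j\<close> is the one at which
  \<open>coeff_gauged_step_eq_0\<close> applies; at \<open>j = Suc N\<close> no power of \<open>a + b F\<close> is left, so every polynomial of
  degree at most \<open>N\<close> is covered.\<close>

lemma Psi_funpow_gauged_poly_eq_0:
  fixes r s u F y :: "real \<Rightarrow> real" and p :: "real poly"
  assumes I: "open I"
    and u: "\<And>x. x \<in> I \<Longrightarrow> (u has_real_derivative u' x) (at x)" "\<And>x. x \<in> I \<Longrightarrow> u x \<noteq> 0"
    and F: "\<And>x. x \<in> I \<Longrightarrow> (F has_real_derivative 1 / (u x)\<^sup>2) (at x)"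
    and r: "\<And>x. x \<in> I \<Longrightarrow> r x = \<sigma> * (u x)\<^sup>2 * (a + b * F x)\<^sup>2"
    and s: "\<And>x. x \<in> I \<Longrightarrow> s x = - real N / 2 * deriv r x"
    and y: "\<And>x. x \<in> I \<Longrightarrow> y x = u x ^ N * (a + b * F x) ^ (Suc N - j) * poly p (F x)"
    and p: "\<And>i. i \<ge> j \<Longrightarrow> coeff p i = 0"
    and "j \<le> Suc N" "x \<in> I"
  shows "(Psi r s ^^ j) y x = 0"
  using y p \<open>j \<le> Suc N\<close>
proof (induction j arbitrary: y p)
  case 0
  then have "p = 0"
    by (simp add: poly_eq_iff)
  then show ?case
    using 0(1)[OF \<open>x \<in> I\<close>] by simp
next
  case (Suc j)
  define q where "q = smult \<sigma> ([:a, b:] * pderiv p - smult (b * (real N - real (N - j))) p)"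
  have "real N - real (N - j) = real j"
    using Suc.prems(3) by simp
  then have "coeff q i = 0" if "i \<ge> j" for i
    using coeff_gauged_step_eq_0[of j p i a b] Suc.prems(2) that by (simp add: q_def)
  moreover have "Psi r s y x = u x ^ N * (a + b * F x) ^ (Suc N - j) * poly q (F x)"
    if "x \<in> I" for x
    using Psi_gauged_poly[OF I that u F r s, of y "N - j" p] Suc.prems(1,3)
    by (simp add: q_def Suc_diff_le)
  ultimately have "(Psi r s ^^ j) (Psi r s y) x = 0"
    using Suc.prems(3) by (intro Suc.IH[of _ q]) auto
  then show ?case
    by (simp only: funpow_Suc_right o_apply)
qed

section \<open>Solutions of the iterative equation\<close>

lemma linearly_independent_on_gauged_powers:
  fixes w F f :: "real \<Rightarrow> real"
  assumes I: "open I" "is_interval I" "I \<noteq> {}"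
    and w: "\<And>x. x \<in> I \<Longrightarrow> w x \<noteq> 0"
    and F: "\<And>x. x \<in> I \<Longrightarrow> (F has_real_derivative f x) (at x)" "\<And>x. x \<in> I \<Longrightarrow> f x > 0"
  shows "linearly_independent_on I n (\<lambda>k x. w x * F x ^ k)"
  unfolding linearly_independent_on_def
proof (intro allI impI)
  fix c :: "nat \<Rightarrow> real" and k
  assume c: "\<forall>x\<in>I. (\<Sum>k<n. c k * (w x * F x ^ k)) = 0" and "k < n"
  have less: "F x < F y" if "x \<in> I" "y \<in> I" "x < y" for x y
  proof (rule DERIV_pos_imp_increasing[OF \<open>x < y\<close>])
    fix t assume "x \<le> t" "t \<le> y"
    then have "t \<in> I"
      using that I(2) unfolding is_interval_1 by blast
    then show "\<exists>d. (F has_real_derivative d) (at t) \<and> d > 0"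
      using F by blast
  qed
  have "inj_on F I"
    by (rule inj_onI) (metis less linorder_less_linear order_less_irrefl)
  moreover have "infinite I"
    using I(1,3) finite_imp_not_open by blast
  ultimately have "infinite (F ` I)"
    using finite_imageD by blast
  moreover define p where "p = (\<Sum>k<n. monom (c k) k)"
  have "F ` I \<subseteq> {t. poly p t = 0}"
  proof
    fix t assume "t \<in> F ` I"
    then obtain x where x: "x \<in> I" "t = F x" by blast
    have "w x * poly p t = (\<Sum>k<n. c k * (w x * F x ^ k))"
      by (simp add: p_def poly_sum poly_monom x sum_distrib_left mult_ac)
    then show "t \<in> {t. poly p t = 0}"
      using c x w by simp
  qed
  ultimately have "p = 0"
    using poly_roots_finite finite_subset by blast
  then have "coeff p k = 0" by simp
  then show "c k = 0"
    using \<open>k < n\<close> by (simp add: p_def coeff_sum)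
qed

theorem mainTheorem3:
  fixes n :: nat and I :: "real set" and A :: "nat \<Rightarrow> real \<Rightarrow> real"
    and q u F :: "real \<Rightarrow> real"
  assumes n: "n \<ge> 2"
    and I: "open I" "is_interval I" "I \<noteq> {}"
    and A: "\<And>j. j \<in> {2..n} \<Longrightarrow> smooth_on I (A j)"
    and iter: "iterative_equation I n (normal_form_op n A)"
    and q: "\<And>x. x \<in> I \<Longrightarrow> q x = A 2 x / real ((n + 1) choose 3)"
    and u: "solution_on I (\<lambda>y x. (deriv ^^ 2) y x + q x * y x) u"
    and u_nz: "\<And>x. x \<in> I \<Longrightarrow> u x \<noteq> 0"
    and F: "\<And>x. x \<in> I \<Longrightarrow> (F has_real_derivative 1 / (u x)\<^sup>2) (at x)"
  shows "(\<forall>k<n. solution_on I (normal_form_op n A) (\<lambda>x. u x ^ (n - 1) * F x ^ k)) \<and>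
         linearly_independent_on I n (\<lambda>k x. u x ^ (n - 1) * F x ^ k)"
proof (intro conjI allI impI)
  obtain r s where rs: "smooth_on I r" "smooth_on I s" "\<And>x. x \<in> I \<Longrightarrow> r x \<noteq> 0"
    and same: "same_equation I (normal_form_op n A) (Psi r s ^^ n)"
    using iter unfolding iterative_equation_def by blast
  have coeffs: "s x = - (real n - 1) / 2 * deriv r x"
    "A 2 x * (r x)\<^sup>2 = real ((n + 1) choose 3) * ((deriv r x)\<^sup>2 - 2 * r x * deriv (deriv r) x) / 4"
    if "x \<in> I" for x
    using iterative_normal_form_coeffs[OF I(1) rs(1,2) _ same n that] rs(3) by blast+
  have u_smooth: "smooth_on I u" and u_eq: "\<And>x. x \<in> I \<Longrightarrow> deriv (deriv u) x + q x * u x = 0"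
    using u by (auto simp: solution_on_def eval_nat_numeral)
  have q_eq: "q x * (r x)\<^sup>2 = ((deriv r x)\<^sup>2 - 2 * r x * deriv (deriv r) x) / 4" if "x \<in> I" for x
  proof -
    define C where "C = real ((n + 1) choose 3)"
    have "C \<noteq> 0"
      using n by (simp add: C_def)
    moreover from this have "A 2 x = C * q x"
      using q[OF that] unfolding C_def by simp
    ultimately show ?thesis
      using coeffs(2)[OF that] unfolding C_def[symmetric] by simp
  qed
  obtain \<sigma> a b where r_eq: "\<And>x. x \<in> I \<Longrightarrow> r x = \<sigma> * (u x)\<^sup>2 * (a + b * F x)\<^sup>2"
    using leading_coeff_factorization[OF I(1,2) rs(1,3) q_eq u_smooth u_eq u_nz F] by blast
  have s_eq: "s x = - real (n - 1) / 2 * deriv r x" if "x \<in> I" for x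
    using coeffs(1)[OF that] n by (simp add: of_nat_diff)
  have F_smooth: "smooth_on I F"
  proof (rule smooth_on_antiderivative[OF I(1)])
    show "smooth_on I (\<lambda>x. inverse ((u x)\<^sup>2))"
      using u_smooth u_nz I(1) by (intro smooth_on_inverse smooth_on_power) auto
  qed (use F in \<open>simp add: inverse_eq_divide\<close>)
  fix k assume "k < n"
  have smooth: "smooth_on I (\<lambda>x. u x ^ (n - 1) * F x ^ k)"
    using u_smooth F_smooth I(1) by (intro smooth_on_mult smooth_on_power)
  obtain m where m: "\<And>x. x \<in> I \<Longrightarrow> m x \<noteq> 0" "\<And>y x. smooth_on I y \<Longrightarrow> x \<in> I \<Longrightarrow>
      (Psi r s ^^ n) y x = m x * normal_form_op n A y x"
    using same unfolding same_equation_def by blast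
  have "normal_form_op n A (\<lambda>x. u x ^ (n - 1) * F x ^ k) x = 0" if "x \<in> I" for x
  proof -
    have "(Psi r s ^^ n) (\<lambda>x. u x ^ (n - 1) * F x ^ k) x = 0"
      by (rule Psi_funpow_gauged_poly_eq_0[OF I(1) smooth_on_DERIV[OF u_smooth] u_nz F r_eq s_eq,
            where p = "monom 1 k"])
         (use n \<open>k < n\<close> that in \<open>auto simp: poly_monom\<close>)
    then show ?thesis
      using m(2)[OF smooth that] m(1)[OF that] by simp
  qed
  with smooth show "solution_on I (normal_form_op n A) (\<lambda>x. u x ^ (n - 1) * F x ^ k)"
    by (simp add: solution_on_def)
next
  show "linearly_independent_on I n (\<lambda>k x. u x ^ (n - 1) * F x ^ k)"
    by (rule linearly_independent_on_gauged_powers[OF I _ F]) (use u_nz in auto)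
qed

end
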